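(* For every sequence number $s$, if the subtree $T(s)$ of $T$ rooted at $s$ is well founded, then $B_0\underline{s} =_{\omega} B_1\underline{s}$.
   Context: Untyped $\lambda$-calculus; $[N/x]U$ is capture-avoiding substitution; $\underline{k}$ is the $k$-th Church numeral; $\mathbf{\Omega} \equiv (\lambda x.xx)(\lambda x.xx)$; $\mathbf{K^*} \equiv \lambda ab.b$; a closed term is unsolvable if no application of it to closed terms $\beta$-converts to $\lambda x.x$. The relation $=_{\omega}$ on closed terms is the least relation containing $M=_\omega M$, $(\lambda x.U)N =_{\omega} [N/x]U$ and its symmetric version for closed $(\lambda x.U)N$, $M=_\omega\mathbf{\Omega}$ and $\mathbf{\Omega}=_\omega M$ for closed unsolvable $M$, closed under the Leibniz rule (from $[M/z]X =_{\omega} [M/z]Y$ and $M =_{\omega} N$, with $X,Y$ having at most $z$ free, infer $[N/z]X =_{\omega} [N/z]Y$) and the $\omega$-rule (from $PM=_\omega QM$ for all closed $M$ infer $P=_\omega Q$). Fix an effective coding of finite sequences of natural numbers by natural numbers ("sequence numbers"); $s' < s$ means $s'$ is a proper initial subsequence of $s$; $\bar f(m)$ is the code of $\langle f(0),\dots,f(m-1)\rangle$. Fix a $\mathbf{\Pi^1_1}$ predicate $P(n) \Leftrightarrow \forall f\,\exists m\, R(\bar f(m), n)$ with $R$ recursive, and fix $n$. $s$ is $n$-unsecured if there is no $s'<s$ with $R(s',n)$; $T$ is the (recursive) tree of $n$-unsecured sequence numbers; $T(s)$ is the set of elements of $T$ extending $s$ (empty if $s\notin T$); a tree is well founded if it has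 no infinite strictly increasing chain. Let $*$ be a closed term (written infix) representing concatenation of sequence numbers such that $\underline{s}*z$ has a $\beta\mathbf{\Omega}$-normal form beginning with $z$, and let $x^{+}$ denote a closed successor term applied to $x$. Let $D$ be a closed term such that: for every numeral $\underline{m}$, $Dx\underline{m}$ has a $\beta\mathbf{\Omega}$-normal form beginning with $x$ and containing $\underline{m}$; $D\underline{s} =_\omega \mathbf{K^*}$ if $s\in T$ and $D\underline{s}=_\omega \mathbf{\Omega}$ otherwise; and if $s\in T$ then $D\underline{s}$ reduces to $\mathbf{K^*}$ by head $\beta$-reductions whose redexes are closed. Write $[A,B] \equiv \lambda z.zAB$. Define $\mathbf{\Theta} \equiv (\lambda ab.b(aab))(\lambda ab.b(aab))$, and for $i=0,1$: $F_i \equiv \lambda wxy.\, Dx\underline{i}(\lambda ab.b(aab))(\lambda ab.b(aab))(\lambda axf.[fx,\ x(\lambda u.u\mathbf{\Omega})y(a(x^{+})f)])\underline{0}(\lambda z.w(x*z))$ and $B_i \equiv \mathbf{\Theta}F_i$. *)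

theory Defs
  imports Main "HOL-Library.Sublist"
begin

section \<open>Untyped lambda terms\<close>

text \<open>Terms up to alpha-equivalence are represented with de Bruijn indices.\<close>

datatype trm = Var nat | App trm trm (infixl \<open>\<degree>\<close> 200) | Abs trm

primrec lift :: "nat \<Rightarrow> trm \<Rightarrow> trm" where
  "lift k (Var i) = (if i < k then Var i else Var (Suc i))"
| "lift k (M \<degree> N) = lift k M \<degree> lift k N"
| "lift k (Abs M) = Abs (lift (Suc k) M)"

text \<open>\<open>subst N k U\<close> is $[N/x]U$, where $x$ is the variable with index \<open>k\<close>; that variable
  disappears, so larger indices are decremented.\<close>

primrec subst :: "trm \<Rightarrow> nat \<Rightarrow> trm \<Rightarrow> trm" where
  "subst N k (Var i) = (if i < k then Var i else if i = k then N else Var (i - 1))"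
| "subst N k (U \<degree> V) = subst N k U \<degree> subst N k V"
| "subst N k (Abs U) = Abs (subst (lift 0 N) (Suc k) U)"

text \<open>\<open>closed_at k M\<close>: all free variables of \<open>M\<close> have an index below \<open>k\<close>.\<close>

primrec closed_at :: "nat \<Rightarrow> trm \<Rightarrow> bool" where
  "closed_at k (Var i) \<longleftrightarrow> i < k"
| "closed_at k (M \<degree> N) \<longleftrightarrow> closed_at k M \<and> closed_at k N"
| "closed_at k (Abs M) \<longleftrightarrow> closed_at (Suc k) M"

abbreviation closed_term :: "trm \<Rightarrow> bool" where
  "closed_term M \<equiv> closed_at 0 M"

abbreviation apps :: "trm \<Rightarrow> trm list \<Rightarrow> trm" where
  "apps M Ns \<equiv> foldl App M Ns"

primrec occurs_in :: "trm \<Rightarrow> trm \<Rightarrow> bool" where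
  "occurs_in A (Var i) \<longleftrightarrow> A = Var i"
| "occurs_in A (M \<degree> N) \<longleftrightarrow> A = M \<degree> N \<or> occurs_in A M \<or> occurs_in A N"
| "occurs_in A (Abs M) \<longleftrightarrow> A = Abs M \<or> occurs_in A M"

definition church :: "nat \<Rightarrow> trm" where
  "church k = Abs (Abs (((\<lambda>M. Var 1 \<degree> M) ^^ k) (Var 0)))"

definition Id_trm :: trm where
  "Id_trm = Abs (Var 0)"

definition K_star :: trm where
  "K_star = Abs (Abs (Var 0))"

definition Omega :: trm where
  "Omega = Abs (Var 0 \<degree> Var 0) \<degree> Abs (Var 0 \<degree> Var 0)"

definition pair_trm :: "trm \<Rightarrow> trm \<Rightarrow> trm" where
  "pair_trm A B = Abs (Var 0 \<degree> lift 0 A \<degree> lift 0 B)"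


section \<open>Reduction, conversion, solvability\<close>

inductive beta :: "trm \<Rightarrow> trm \<Rightarrow> bool" where
  beta_redex: "beta (Abs U \<degree> N) (subst N 0 U)"
| beta_appL: "beta M M' \<Longrightarrow> beta (M \<degree> N) (M' \<degree> N)"
| beta_appR: "beta N N' \<Longrightarrow> beta (M \<degree> N) (M \<degree> N')"
| beta_abs: "beta M M' \<Longrightarrow> beta (Abs M) (Abs M')"

abbreviation beta_conv :: "trm \<Rightarrow> trm \<Rightarrow> bool" (infix \<open>=\<^sub>\<beta>\<close> 50) where
  "M =\<^sub>\<beta> N \<equiv> equivclp beta M N"

definition unsolvable :: "trm \<Rightarrow> bool" where
  "unsolvable M \<longleftrightarrow>
     closed_term M \<and> \<not> (\<exists>Ns. (\<forall>N \<in> set Ns. closed_term N) \<and> apps M Ns =\<^sub>\<beta> Id_trm)"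

text \<open>A term with free variables is unsolvable if its closure by abstractions is.\<close>

definition unsolvable_open :: "trm \<Rightarrow> bool" where
  "unsolvable_open M \<longleftrightarrow> (\<exists>k. unsolvable ((Abs ^^ k) M))"

text \<open>In $\beta\Omega$-reduction the term \<open>Omega\<close> plays the role of a constant: it is neither
  contracted by $\beta$ (to itself) nor replaced by itself.\<close>

inductive betaOmega :: "trm \<Rightarrow> trm \<Rightarrow> bool" where
  bO_beta: "Abs U \<degree> N \<noteq> Omega \<Longrightarrow> betaOmega (Abs U \<degree> N) (subst N 0 U)"
| bO_Omega: "unsolvable_open M \<Longrightarrow> M \<noteq> Omega \<Longrightarrow> betaOmega M Omega"
| bO_appL: "betaOmega M M' \<Longrightarrow> betaOmega (M \<degree> N) (M' \<degree> N)"
| bO_appR: "betaOmega N N' \<Longrightarrow> betaOmega (M \<degree> N) (M \<degree> N')"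
| bO_abs: "betaOmega M M' \<Longrightarrow> betaOmega (Abs M) (Abs M')"

definition has_betaOmega_nf :: "trm \<Rightarrow> trm \<Rightarrow> bool" where
  "has_betaOmega_nf M N \<longleftrightarrow> betaOmega\<^sup>*\<^sup>* M N \<and> \<not> (\<exists>N'. betaOmega N N')"

definition begins_with :: "nat \<Rightarrow> trm \<Rightarrow> bool" where
  "begins_with x M \<longleftrightarrow> (\<exists>Ns. M = apps (Var x) Ns)"

text \<open>One head $\beta$-reduction step whose redex is a closed term.\<close>

inductive closed_head_beta :: "trm \<Rightarrow> trm \<Rightarrow> bool" where
  chb_redex: "closed_term (Abs U \<degree> N) \<Longrightarrow> closed_head_beta (Abs U \<degree> N) (subst N 0 U)"
| chb_app: "closed_head_beta M M' \<Longrightarrow> (\<forall>U. M \<noteq> Abs U) \<Longrightarrow> closed_head_beta (M \<degree> N) (M' \<degree> N)"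
| chb_abs: "closed_head_beta M M' \<Longrightarrow> closed_head_beta (Abs M) (Abs M')"


section \<open>The relation $=_\omega$\<close>

text \<open>In the Leibniz rule the variable $z$ is the one with index 0.\<close>

inductive omega_eq :: "trm \<Rightarrow> trm \<Rightarrow> bool" (infix \<open>=\<^sub>\<omega>\<close> 50) where
  oe_refl: "closed_term M \<Longrightarrow> M =\<^sub>\<omega> M"
| oe_beta: "closed_term (Abs U \<degree> N) \<Longrightarrow> Abs U \<degree> N =\<^sub>\<omega> subst N 0 U"
| oe_beta_sym: "closed_term (Abs U \<degree> N) \<Longrightarrow> subst N 0 U =\<^sub>\<omega> Abs U \<degree> N"
| oe_Omega: "unsolvable M \<Longrightarrow> M =\<^sub>\<omega> Omega"
| oe_Omega_sym: "unsolvable M \<Longrightarrow> Omega =\<^sub>\<omega> M"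
| oe_Leibniz: "closed_at 1 X \<Longrightarrow> closed_at 1 Y \<Longrightarrow> subst M 0 X =\<^sub>\<omega> subst M 0 Y \<Longrightarrow> M =\<^sub>\<omega> N \<Longrightarrow>
    subst N 0 X =\<^sub>\<omega> subst N 0 Y"
| oe_omega_rule: "closed_term P \<Longrightarrow> closed_term Q \<Longrightarrow>
    (\<And>M. closed_term M \<Longrightarrow> P \<degree> M =\<^sub>\<omega> Q \<degree> M) \<Longrightarrow> P =\<^sub>\<omega> Q"


section \<open>Recursive functions and sequence numbers\<close>

text \<open>Total recursive functions of a given arity; only the values on lists whose length is
  the arity are meaningful.\<close>

inductive recursive_fun :: "nat \<Rightarrow> (nat list \<Rightarrow> nat) \<Rightarrow> bool" where
  rf_zero: "recursive_fun k (\<lambda>xs. 0)"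
| rf_succ: "recursive_fun 1 (\<lambda>xs. Suc (xs ! 0))"
| rf_proj: "i < k \<Longrightarrow> recursive_fun k (\<lambda>xs. xs ! i)"
| rf_comp: "recursive_fun (length gs) f \<Longrightarrow> \<forall>g \<in> set gs. recursive_fun k g \<Longrightarrow>
    recursive_fun k (\<lambda>xs. f (map (\<lambda>g. g xs) gs))"
| rf_rec: "recursive_fun k g \<Longrightarrow> recursive_fun (Suc (Suc k)) h \<Longrightarrow>
    recursive_fun (Suc k) (\<lambda>xs. rec_nat (g (tl xs)) (\<lambda>y r. h (y # r # tl xs)) (hd xs))"
| rf_min: "recursive_fun (Suc k) g \<Longrightarrow> \<forall>xs. length xs = k \<longrightarrow> (\<exists>y. g (y # xs) = 0) \<Longrightarrow>
    recursive_fun k (\<lambda>xs. LEAST y. g (y # xs) = 0)"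

definition recursive_set :: "nat set \<Rightarrow> bool" where
  "recursive_set A \<longleftrightarrow> (\<exists>f. recursive_fun 1 f \<and> (\<forall>a. f [a] = (if a \<in> A then 1 else 0)))"

definition recursive_rel :: "(nat \<Rightarrow> nat \<Rightarrow> bool) \<Rightarrow> bool" where
  "recursive_rel R \<longleftrightarrow> (\<exists>f. recursive_fun 2 f \<and> (\<forall>a b. f [a, b] = (if R a b then 1 else 0)))"

definition effective_coding :: "(nat list \<Rightarrow> nat) \<Rightarrow> bool" where
  "effective_coding code \<longleftrightarrow>
     inj code \<and> recursive_set (range code) \<and>
     (\<exists>f. recursive_fun 1 f \<and> (\<forall>xs. f [code xs] = length xs)) \<and>
     (\<exists>f. recursive_fun 2 f \<and> (\<forall>xs. \<forall>i < length xs. f [code xs, i] = xs ! i)) \<and>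
     (\<exists>f. recursive_fun 2 f \<and> (\<forall>xs a. f [code xs, a] = code (xs @ [a])))"

definition seq_less :: "(nat list \<Rightarrow> nat) \<Rightarrow> nat \<Rightarrow> nat \<Rightarrow> bool" where
  "seq_less code s' s \<longleftrightarrow> (\<exists>xs ys. s' = code xs \<and> s = code ys \<and> strict_prefix xs ys)"

definition initial_code :: "(nat list \<Rightarrow> nat) \<Rightarrow> (nat \<Rightarrow> nat) \<Rightarrow> nat \<Rightarrow> nat" where
  "initial_code code f m = code (map f [0..<m])"

definition unsecured :: "(nat list \<Rightarrow> nat) \<Rightarrow> (nat \<Rightarrow> nat \<Rightarrow> bool) \<Rightarrow> nat \<Rightarrow> nat \<Rightarrow> bool" where
  "unsecured code R n s \<longleftrightarrow> \<not> (\<exists>s'. seq_less code s' s \<and> R s' n)"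

definition unsecured_tree :: "(nat list \<Rightarrow> nat) \<Rightarrow> (nat \<Rightarrow> nat \<Rightarrow> bool) \<Rightarrow> nat \<Rightarrow> nat set" where
  "unsecured_tree code R n = {s \<in> range code. unsecured code R n s}"

definition subtree :: "(nat list \<Rightarrow> nat) \<Rightarrow> nat set \<Rightarrow> nat \<Rightarrow> nat set" where
  "subtree code T s = (if s \<in> T then {t \<in> T. t = s \<or> seq_less code s t} else {})"

definition well_founded_tree :: "(nat list \<Rightarrow> nat) \<Rightarrow> nat set \<Rightarrow> bool" where
  "well_founded_tree code T \<longleftrightarrow>
     \<not> (\<exists>c :: nat \<Rightarrow> nat. \<forall>i. c i \<in> T \<and> seq_less code (c i) (c (Suc i)))"


section \<open>The terms $F_i$ and $B_i$\<close>

text \<open>$\lambda ab.b(aab)$\<close>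

definition Theta_half :: trm where
  "Theta_half = Abs (Abs (Var 0 \<degree> (Var 1 \<degree> Var 1 \<degree> Var 0)))"

definition Theta :: trm where
  "Theta = Theta_half \<degree> Theta_half"

text \<open>$\lambda axf.[fx,\ x(\lambda u.u\Omega)y(a(x^+)f)]$, to be placed directly under the binder
  of $y$: inside the three abstractions $f, x, a, y$ have indices 0, 1, 2, 3.
  The argument \<open>Sc\<close> is the successor term.\<close>

definition G_trm :: "trm \<Rightarrow> trm" where
  "G_trm Sc = Abs (Abs (Abs (pair_trm
     (Var 0 \<degree> Var 1)
     (Var 1 \<degree> Abs (Var 0 \<degree> Omega) \<degree> Var 3 \<degree> (Var 2 \<degree> (Sc \<degree> Var 1) \<degree> Var 0)))))"

text \<open>Under $\lambda wxy$ the variables $y, x, w$ have indices 0, 1, 2. The parameters \<open>D\<close>,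
  \<open>cc\<close> (the concatenation $s*a$ of a sequence with one further entry) and \<open>Sc\<close> stand for closed terms, hence need no lifting.\<close>

definition F_trm :: "trm \<Rightarrow> trm \<Rightarrow> trm \<Rightarrow> nat \<Rightarrow> trm" where
  "F_trm D cc Sc i = Abs (Abs (Abs (
     D \<degree> Var 1 \<degree> church i \<degree> Theta_half \<degree> Theta_half \<degree> G_trm Sc \<degree> church 0 \<degree>
     Abs (Var 3 \<degree> (cc \<degree> Var 2 \<degree> Var 0)))))"

definition B_trm :: "trm \<Rightarrow> trm \<Rightarrow> trm \<Rightarrow> nat \<Rightarrow> trm" where
  "B_trm D cc Sc i = Theta \<degree> F_trm D cc Sc i"

end

theory Submission
  imports Defs "HOL-Library.Confluence"
begin

text \<open>If $B_0\underline{s}$ and $B_1\underline{s}$ differ, then $s \in T$, since otherwise both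
  send every closed $M$ to $\Omega$. For $s \in T$ and closed $M$, the term $B_i\underline{s}M$ is a
  stream whose $k$-th entry is $B_i$ at the $k$-th child of $s$ and whose $k$-th tail is guarded by
  $M\Omega\cdots\Omega$ with $k$ copies of $\Omega$. For large $k$ this guard is unsolvable, so the
  stream depends on finitely many entries only, and $B_0$, $B_1$ differ at some child of $s$.
  Iterating this produces an infinite branch of $T(s)$.\<close>

section \<open>Substitution and closed terms\<close>

lemma lift_lift:
  "i \<le> k \<Longrightarrow> lift (Suc k) (lift i M) = lift i (lift k M)"
  by (induction M arbitrary: i k) auto

lemma lift_subst_ge:
  "j \<le> i \<Longrightarrow> lift i (subst N j M) = subst (lift i N) j (lift (Suc i) M)"
  by (induction M arbitrary: i j N) (auto simp: lift_lift)

lemma lift_subst_le: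
  "i \<le> j \<Longrightarrow> lift i (subst N j M) = subst (lift i N) (Suc j) (lift i M)"
  by (induction M arbitrary: i j N) (auto simp: lift_lift)

lemma subst_lift_cancel [simp]: "subst N k (lift k M) = M"
  by (induction M arbitrary: k N) auto

text \<open>The inner substitution removes an index at or below \<open>j\<close>, so the variable
  now numbered \<open>j\<close> was \<open>Suc j\<close> before it. Contraction thereby commutes
  with substitution.\<close>

lemma subst_subst:
  "i \<le> j \<Longrightarrow>
    subst V j (subst N i M) = subst (subst V j N) i (subst (lift i V) (Suc j) M)"
  by (induction M arbitrary: i j N V) (auto simp: lift_lift lift_subst_le)

lemma closed_at_mono: "closed_at k M \<Longrightarrow> k \<le> l \<Longrightarrow> closed_at l M"
  by (induction M arbitrary: k l) auto

lemma lift_closed_at: "closed_at k M \<Longrightarrow> k \<le> l \<Longrightarrow> lift l M = M"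
  by (induction M arbitrary: k l) auto

lemma subst_closed_at: "closed_at k M \<Longrightarrow> k \<le> l \<Longrightarrow> subst N l M = M"
  by (induction M arbitrary: k l N) auto

lemma lift_closed [simp]: "closed_term M \<Longrightarrow> lift k M = M"
  by (rule lift_closed_at) auto

lemma subst_closed [simp]: "closed_term M \<Longrightarrow> subst N k M = M"
  by (rule subst_closed_at) auto

lemma closed_term_closed_at [simp]: "closed_term M \<Longrightarrow> closed_at k M"
  by (rule closed_at_mono) auto

lemma closed_at_lift: "closed_at k M \<Longrightarrow> closed_at (Suc k) (lift i M)"
  by (induction M arbitrary: i k) auto

lemma closed_at_subst:
  "closed_at (Suc k) M \<Longrightarrow> closed_at k N \<Longrightarrow> i \<le> k \<Longrightarrow> closed_at k (subst N i M)"
  by (induction M arbitrary: i k N) (auto simp: closed_at_lift)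

lemma closed_at_beta: "beta M N \<Longrightarrow> closed_at k M \<Longrightarrow> closed_at k N"
  by (induction arbitrary: k rule: beta.induct) (auto intro: closed_at_subst)

lemma closed_at_beta_star: "beta\<^sup>*\<^sup>* M N \<Longrightarrow> closed_at k M \<Longrightarrow> closed_at k N"
  by (induction rule: rtranclp_induct) (auto intro: closed_at_beta)

lemma closed_term_apps:
  "closed_term (apps M Ns) \<longleftrightarrow> closed_term M \<and> (\<forall>N \<in> set Ns. closed_term N)"
  by (induction Ns arbitrary: M) auto

lemma closed_Omega [simp]: "closed_term Omega"
  by (simp add: Omega_def)

lemma closed_Theta_half [simp]: "closed_term Theta_half"
  by (simp add: Theta_half_def)

lemma closed_Theta [simp]: "closed_term Theta"
  by (simp add: Theta_def)

lemma closed_church [simp]: "closed_term (church k)"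
proof -
  have "closed_at 2 (((\<lambda>M. Var 1 \<degree> M) ^^ k) (Var 0))"
    by (induction k) auto
  then show ?thesis
    by (simp add: church_def numeral_2_eq_2)
qed

lemma closed_pair_trm [simp]:
  "closed_term A \<Longrightarrow> closed_term B \<Longrightarrow> closed_term (pair_trm A B)"
  by (simp add: pair_trm_def)


section \<open>Confluence of beta reduction\<close>

lemma beta_star_abs: "beta\<^sup>*\<^sup>* M N \<Longrightarrow> beta\<^sup>*\<^sup>* (Abs M) (Abs N)"
  by (induction rule: rtranclp_induct) (auto intro: beta_abs rtranclp.rtrancl_into_rtrancl)

lemma beta_star_appL: "beta\<^sup>*\<^sup>* M M' \<Longrightarrow> beta\<^sup>*\<^sup>* (M \<degree> N) (M' \<degree> N)"
  by (induction rule: rtranclp_induct) (auto intro: beta_appL rtranclp.rtrancl_into_rtrancl)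

lemma beta_star_appR: "beta\<^sup>*\<^sup>* N N' \<Longrightarrow> beta\<^sup>*\<^sup>* (M \<degree> N) (M \<degree> N')"
  by (induction rule: rtranclp_induct) (auto intro: beta_appR rtranclp.rtrancl_into_rtrancl)

lemma beta_star_app:
  "beta\<^sup>*\<^sup>* M M' \<Longrightarrow> beta\<^sup>*\<^sup>* N N' \<Longrightarrow> beta\<^sup>*\<^sup>* (M \<degree> N) (M' \<degree> N')"
  by (meson beta_star_appL beta_star_appR rtranclp_trans)

text \<open>Parallel reduction in the style of Tait and Martin-Loef: one step contracts any set of
  redexes already present. Unlike \<open>beta\<close>, it closes every fork in a single
  step.\<close>

inductive par :: "trm \<Rightarrow> trm \<Rightarrow> bool" where
  par_var: "par (Var i) (Var i)"
| par_app: "par M M' \<Longrightarrow> par N N' \<Longrightarrow> par (M \<degree> N) (M' \<degree> N')"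
| par_abs: "par M M' \<Longrightarrow> par (Abs M) (Abs M')"
| par_redex: "par U U' \<Longrightarrow> par N N' \<Longrightarrow> par (Abs U \<degree> N) (subst N' 0 U')"

lemma par_refl: "par M M"
  by (induction M) (auto intro: par.intros)

lemma beta_imp_par: "beta M N \<Longrightarrow> par M N"
  by (induction rule: beta.induct) (auto intro: par.intros par_refl)

lemma par_imp_beta_star: "par M N \<Longrightarrow> beta\<^sup>*\<^sup>* M N"
proof (induction rule: par.induct)
  case (par_redex U U' N N')
  then have "beta\<^sup>*\<^sup>* (Abs U \<degree> N) (Abs U' \<degree> N')"
    by (intro beta_star_app beta_star_abs)
  then show ?case
    by (rule rtranclp.rtrancl_into_rtrancl) (rule beta_redex)
qed (auto intro: beta_star_app beta_star_abs)

lemma par_lift: "par M N \<Longrightarrow> par (lift k M) (lift k N)"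
  by (induction arbitrary: k rule: par.induct) (auto simp: lift_subst_ge intro: par.intros)

lemma par_subst:
  "par M M' \<Longrightarrow> par N N' \<Longrightarrow> par (subst N k M) (subst N' k M')"
proof (induction arbitrary: N N' k rule: par.induct)
  case (par_redex U U' P P')
  have "par (Abs (subst (lift 0 N) (Suc k) U) \<degree> subst N k P)
      (subst (subst N' k P') 0 (subst (lift 0 N') (Suc k) U'))"
    using par_redex by (intro par.par_redex) (auto intro: par_lift)
  then show ?case
    by (simp add: subst_subst)
next
  case (par_abs M M')
  then show ?case
    by (simp add: par.par_abs par_lift)
qed (auto intro: par.intros)

text \<open>Takahashi's complete development: all redexes present are contracted at once.\<close>

fun develop :: "trm \<Rightarrow> trm" where
  "develop (Var i) = Var i"
| "develop (Abs M) = Abs (develop M)"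
| "develop (Abs U \<degree> N) = subst (develop N) 0 (develop U)"
| "develop (M \<degree> N) = develop M \<degree> develop N"

inductive_cases par_AbsE: "par (Abs M) N"

text \<open>The triangle property: the redexes that a step has left alone can be contracted in one
  more step. Hence \<open>develop M\<close> closes every fork from \<open>M\<close>.\<close>

lemma par_develop: "par M N \<Longrightarrow> par N (develop M)"
proof (induction rule: par.induct)
  case (par_app M M' N N')
  show ?case
  proof (cases M)
    case (Abs U)
    with par_app obtain U' where "M' = Abs U'" "par U' (develop U)"
      by (auto elim!: par_AbsE)
    then show ?thesis
      using par_app Abs by (auto intro: par.intros)
  qed (use par_app in \<open>auto intro: par.intros\<close>)
qed (auto intro: par.intros par_subst)

lemma beta_star_eq_par_star: "beta\<^sup>*\<^sup>* = par\<^sup>*\<^sup>*"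
  by (rule rtranclp_subset[symmetric]) (auto intro: beta_imp_par par_imp_beta_star)

lemma confluentp_beta: "confluentp beta"
proof -
  have "strong_confluentp par"
    by (rule strong_confluentpI) (blast intro: par_develop)
  then have "confluentp par"
    by (rule strong_confluentp_imp_confluentp)
  then show ?thesis
    by (simp add: confluentp_def rtranclp_conversep beta_star_eq_par_star)
qed

lemma beta_conv_joinable: "M =\<^sub>\<beta> N \<Longrightarrow> \<exists>L. beta\<^sup>*\<^sup>* M L \<and> beta\<^sup>*\<^sup>* N L"
  using semiconfluentp_equivclp[OF confluentp_imp_semiconfluentp[OF confluentp_beta]]
  by (auto simp: rtranclp_conversep)

lemma beta_star_imp_conv: "beta\<^sup>*\<^sup>* M N \<Longrightarrow> M =\<^sub>\<beta> N"
  using rtranlcp_le_equivclp[of beta] by blast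

text \<open>The identity is normal, so the common reduct supplied by confluence can only be the
  identity itself.\<close>

lemma beta_conv_Id:
  assumes "M =\<^sub>\<beta> Id_trm"
  shows "beta\<^sup>*\<^sup>* M Id_trm"
proof -
  have "L = Id_trm" if "beta\<^sup>*\<^sup>* Id_trm L" for L
    using that by (induction rule: rtranclp_induct) (auto simp: Id_trm_def elim: beta.cases)
  then show ?thesis
    using beta_conv_joinable[OF assms] by auto
qed


section \<open>Genericity of Omega\<close>

lemma beta_Omega_iff [simp]: "beta Omega M \<longleftrightarrow> M = Omega"
proof
  show "beta Omega M \<Longrightarrow> M = Omega"
    by (auto simp: Omega_def elim!: beta.cases)
  show "M = Omega \<Longrightarrow> beta Omega M"
    using beta_redex[of "Var 0 \<degree> Var 0" "Abs (Var 0 \<degree> Var 0)"] by (simp add: Omega_def)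
qed

lemma Omega_neq_Abs [simp]: "Abs M \<noteq> Omega" "Omega \<noteq> Abs M"
  by (auto simp: Omega_def)

inductive_cases beta_AppE: "beta (M \<degree> N) L"

text \<open>The head \<open>Omega\<close> never becomes an abstraction, so a step takes place inside
  it, where it loops, or inside one argument.\<close>

lemma beta_apps_Omega:
  "beta (apps Omega Ns) M \<Longrightarrow> \<exists>Ns'. M = apps Omega Ns'"
proof (induction Ns arbitrary: M rule: rev_induct)
  case Nil
  then show ?case
    by (auto intro: exI[of _ "[]"])
next
  case (snoc N Ns)
  have not_Abs: "apps Omega Ns \<noteq> Abs U" for U
    by (cases Ns rule: rev_cases) auto
  have "beta (apps Omega Ns \<degree> N) M"
    using snoc.prems by simp
  then consider
      (head) M' where "M = M' \<degree> N" "beta (apps Omega Ns) M'"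
    | (arg) N' where "M = apps Omega Ns \<degree> N'"
    using not_Abs by (elim beta_AppE) metis+
  then show ?case
  proof cases
    case head
    with snoc.IH obtain Ns' where "M = apps Omega (Ns' @ [N])"
      by auto
    then show ?thesis ..
  next
    case arg
    then have "M = apps Omega (Ns @ [N'])"
      by simp
    then show ?thesis ..
  qed
qed

text \<open>Every reduct of \<open>Omega\<close> applied to arguments keeps the head
  \<open>Omega\<close>, whereas the identity is an abstraction.\<close>

lemma unsolvable_Omega: "unsolvable Omega"
  unfolding unsolvable_def
proof (intro conjI notI; (elim exE conjE)?)
  fix Ns assume "apps Omega Ns =\<^sub>\<beta> Id_trm"
  then have "beta\<^sup>*\<^sup>* (apps Omega Ns) Id_trm"
    by (rule beta_conv_Id)
  moreover have "\<exists>Ns'. M = apps Omega Ns'" if "beta\<^sup>*\<^sup>* (apps Omega Ns) M" for M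
    using that by (induction rule: rtranclp_induct) (auto dest: beta_apps_Omega)
  ultimately obtain Ns' where "Id_trm = apps Omega Ns'"
    by blast
  then show False
    by (cases Ns' rule: rev_cases) (auto simp: Id_trm_def)
qed simp

text \<open>\<open>fills M M'\<close>: some occurrences of \<open>Omega\<close> in \<open>M\<close> are replaced by arbitrary terms. Since
  \<open>Omega\<close> only reduces to itself, a filled term can mimic every reduction of the original.\<close>

inductive fills :: "trm \<Rightarrow> trm \<Rightarrow> bool" where
  fills_var: "fills (Var i) (Var i)"
| fills_app: "fills M M' \<Longrightarrow> fills N N' \<Longrightarrow> fills (M \<degree> N) (M' \<degree> N')"
| fills_abs: "fills M M' \<Longrightarrow> fills (Abs M) (Abs M')"
| fills_Omega: "fills Omega M"

lemma fills_refl: "fills M M"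
  by (induction M) (auto intro: fills.intros)

lemma fills_lift: "fills M M' \<Longrightarrow> fills (lift k M) (lift k M')"
  by (induction arbitrary: k rule: fills.induct) (auto intro: fills.intros)

lemma fills_subst:
  "fills M M' \<Longrightarrow> fills N N' \<Longrightarrow> fills (subst N k M) (subst N' k M')"
proof (induction arbitrary: k N N' rule: fills.induct)
  case (fills_abs M M')
  then show ?case
    by (simp add: fills.fills_abs fills_lift)
qed (auto intro: fills.intros)

inductive_cases fills_AbsE: "fills (Abs M) M'"
inductive_cases fills_AppE: "fills (M \<degree> N) M'"

lemma fills_beta:
  "beta M N \<Longrightarrow> fills M M' \<Longrightarrow> \<exists>N'. beta\<^sup>*\<^sup>* M' N' \<and> fills N N'"
proof (induction arbitrary: M' rule: beta.induct)
  case (beta_redex U N)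
  from beta_redex consider
      (app) M1 N1 where "M' = M1 \<degree> N1" "fills (Abs U) M1" "fills N N1"
    | (Omega) "Abs U \<degree> N = Omega"
    by (auto elim: fills_AppE)
  then show ?case
  proof cases
    case app
    then obtain U' where "M1 = Abs U'" "fills U U'"
      by (auto elim: fills_AbsE)
    with app show ?thesis
      by (auto intro: beta.beta_redex fills_subst)
  next
    \<comment> \<open>The only step from \<open>Omega\<close> loops, so the hole survives and the
      filled term need not move.\<close>
    case Omega
    then have "subst N 0 U = Omega"
      using beta.beta_redex[of U N] by simp
    then show ?thesis
      by (auto intro: fills_Omega)
  qed
next
  case (beta_appL M M1 N)
  from beta_appL.prems consider
      (app) M2 N2 where "M' = M2 \<degree> N2" "fills M M2" "fills N N2"
    | (Omega) "M \<degree> N = Omega"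
    by (auto elim: fills_AppE)
  then show ?case
  proof cases
    case app
    then show ?thesis
      using beta_appL.IH by (blast intro: beta_star_appL fills_app)
  next
    case Omega
    then have "M1 \<degree> N = Omega"
      using beta.beta_appL[OF beta_appL.hyps, of N] by simp
    then show ?thesis
      by (auto intro: fills_Omega)
  qed
next
  case (beta_appR N N1 M)
  from beta_appR.prems consider
      (app) M2 N2 where "M' = M2 \<degree> N2" "fills M M2" "fills N N2"
    | (Omega) "M \<degree> N = Omega"
    by (auto elim: fills_AppE)
  then show ?case
  proof cases
    case app
    then show ?thesis
      using beta_appR.IH by (blast intro: beta_star_appR fills_app)
  next
    case Omega
    then have "M \<degree> N1 = Omega"
      using beta.beta_appR[OF beta_appR.hyps, of M] by simp
    then show ?thesis
      by (auto intro: fills_Omega)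
  qed
next
  case (beta_abs M N)
  then show ?case
    by (elim fills_AbsE) (auto, blast intro: beta_star_abs fills_abs)
qed

lemma fills_beta_star:
  "beta\<^sup>*\<^sup>* M N \<Longrightarrow> fills M M' \<Longrightarrow> \<exists>N'. beta\<^sup>*\<^sup>* M' N' \<and> fills N N'"
  by (induction rule: rtranclp_induct) (auto, meson fills_beta rtranclp_trans)

lemma fills_Id: "fills Id_trm M \<Longrightarrow> M = Id_trm"
  by (auto simp: Id_trm_def Omega_def elim!: fills_AbsE elim: fills.cases)

lemma fills_apps:
  "fills M M' \<Longrightarrow> list_all2 fills Ns Ns' \<Longrightarrow> fills (apps M Ns) (apps M' Ns')"
  by (induction Ns arbitrary: M M' Ns') (auto simp: list_all2_Cons1 fills_app)

text \<open>If \<open>M Ns\<close> converts to the identity and \<open>n = length Ns\<close>, then already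
  \<open>M Omega ... Omega\<close> with \<open>n + 1\<close> arguments is unsolvable: otherwise filling the first \<open>n\<close>
  of them with \<open>Ns\<close> would make \<open>Omega\<close> solvable.\<close>

lemma unsolvable_apps_Omega:
  assumes M: "closed_term M"
  shows "\<exists>k. unsolvable (apps M (replicate k Omega))"
proof (cases "unsolvable M")
  case True
  then show ?thesis
    by (intro exI[of _ 0]) simp
next
  case False
  with M obtain Ns where Ns: "apps M Ns =\<^sub>\<beta> Id_trm"
    by (auto simp: unsolvable_def)
  let ?k = "length Ns"
  have False if "\<forall>P \<in> set Ps. closed_term P"
    and eq: "apps (apps M (replicate (Suc ?k) Omega)) Ps =\<^sub>\<beta> Id_trm" for Ps
  proof -
    have "fills (apps M (replicate ?k Omega)) (apps M Ns)"
      by (intro fills_apps fills_refl) (auto simp: list_all2_conv_all_nth intro: fills_Omega)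
    then have "fills (apps (apps M (replicate ?k Omega)) (Omega # Ps))
        (apps (apps M Ns) (Omega # Ps))"
      by (rule fills_apps) (auto intro: list.rel_refl fills_refl)
    moreover have "apps (apps M (replicate (Suc ?k) Omega)) Ps =
        apps (apps M (replicate ?k Omega)) (Omega # Ps)"
      by (simp flip: replicate_append_same)
    ultimately have "beta\<^sup>*\<^sup>* (apps (apps M Ns) (Omega # Ps)) Id_trm"
      using fills_beta_star[OF beta_conv_Id[OF eq]] fills_Id by metis
    \<comment> \<open>The filled holes produce the identity, which returns the one
      \<open>Omega\<close> left over.\<close>
    moreover have "beta\<^sup>*\<^sup>* (apps (apps M Ns) (Omega # Ps)) (apps Omega Ps)"
    proof -
      have apps_mono: "beta\<^sup>*\<^sup>* (apps A Ps) (apps A' Ps)" if "beta\<^sup>*\<^sup>* A A'" for A A'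
        using that by (induction Ps arbitrary: A A') (auto intro: beta_star_appL)
      have "beta (Id_trm \<degree> Omega) Omega"
        using beta_redex[of "Var 0" Omega] by (simp add: Id_trm_def)
      then have "beta\<^sup>*\<^sup>* (apps M Ns \<degree> Omega) Omega"
        using beta_star_appL[OF beta_conv_Id[OF Ns], of Omega] by simp
      then show ?thesis
        by (simp add: apps_mono)
    qed
    ultimately have "apps Omega Ps =\<^sub>\<beta> Id_trm"
      by (meson beta_star_imp_conv equivclp_sym equivclp_trans)
    then show False
      using unsolvable_Omega that(1) by (auto simp: unsolvable_def)
  qed
  then have "unsolvable (apps M (replicate (Suc ?k) Omega))"
    using M unfolding unsolvable_def closed_term_apps by auto
  then show ?thesis ..
qed

lemma unsolvable_app:
  assumes "unsolvable M" "closed_term N"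
  shows "unsolvable (M \<degree> N)"
  unfolding unsolvable_def
proof (intro conjI notI; (elim exE conjE)?)
  show "closed_term (M \<degree> N)"
    using assms by (simp add: unsolvable_def)
  fix Ns assume "\<forall>P \<in> set Ns. closed_term P" "apps (M \<degree> N) Ns =\<^sub>\<beta> Id_trm"
  then have "\<forall>P \<in> set (N # Ns). closed_term P" "apps M (N # Ns) =\<^sub>\<beta> Id_trm"
    using assms by auto
  then show False
    using assms(1) unfolding unsolvable_def by blast
qed


section \<open>The omega theory as a congruence\<close>

lemma omega_eq_closed: "M =\<^sub>\<omega> N \<Longrightarrow> closed_term M \<and> closed_term N"
  by (induction rule: omega_eq.induct) (auto simp: unsolvable_def intro: closed_at_subst)

text \<open>The Leibniz rule with the closed term \<open>subst M 0 X\<close> as its first context: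
  that side ignores the replacement of \<open>M\<close> by \<open>N\<close>, and the premise is
  reflexivity.\<close>

lemma omega_eq_subst:
  assumes "closed_at 1 X" "M =\<^sub>\<omega> N"
  shows "subst M 0 X =\<^sub>\<omega> subst N 0 X"
proof -
  have "closed_term (subst M 0 X)"
    using assms omega_eq_closed by (auto intro: closed_at_subst)
  then show ?thesis
    using oe_Leibniz[of "subst M 0 X" X M N] assms oe_refl by simp
qed

text \<open>Leibniz with the contexts \<open>Var 0\<close> and \<open>M\<close>: in
  \<open>M =\<^sub>\<omega> M\<close> only the left side is replaced.\<close>

lemma omega_eq_sym: "M =\<^sub>\<omega> N \<Longrightarrow> N =\<^sub>\<omega> M"
  using oe_Leibniz[of "Var 0" M M N] omega_eq_closed oe_refl by simp

lemma omega_eq_trans [trans]: "M =\<^sub>\<omega> N \<Longrightarrow> N =\<^sub>\<omega> P \<Longrightarrow> M =\<^sub>\<omega> P"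
  using oe_Leibniz[of M "Var 0" N P] omega_eq_closed by simp

lemma omega_eq_app:
  assumes "M =\<^sub>\<omega> M'" "N =\<^sub>\<omega> N'"
  shows "M \<degree> N =\<^sub>\<omega> M' \<degree> N'"
proof -
  note closed = assms[THEN omega_eq_closed]
  have "M \<degree> N =\<^sub>\<omega> M' \<degree> N"
    using omega_eq_subst[of "Var 0 \<degree> N"] assms closed by simp
  also have "M' \<degree> N =\<^sub>\<omega> M' \<degree> N'"
    using omega_eq_subst[of "M' \<degree> Var 0"] assms closed by simp
  finally show ?thesis .
qed

text \<open>Substituting the outermost variable first keeps the remaining indices in place, so that
  the closed instances of \<open>Abs U\<close> are abstractions of instances of \<open>U\<close>.\<close>

primrec closed_instances_eq :: "nat \<Rightarrow> trm \<Rightarrow> trm \<Rightarrow> bool" where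
  "closed_instances_eq 0 M N \<longleftrightarrow> M =\<^sub>\<omega> N"
| "closed_instances_eq (Suc k) M N \<longleftrightarrow>
     (\<forall>P. closed_term P \<longrightarrow> closed_instances_eq k (subst P k M) (subst P k N))"

lemma closed_instances_eq_refl: "closed_at k M \<Longrightarrow> closed_instances_eq k M M"
  by (induction k arbitrary: M) (simp_all add: oe_refl closed_at_subst)

lemma closed_instances_eq_app:
  "closed_instances_eq k M M' \<Longrightarrow> closed_instances_eq k N N' \<Longrightarrow>
    closed_instances_eq k (M \<degree> N) (M' \<degree> N')"
  by (induction k arbitrary: M M' N N') (auto intro: omega_eq_app)

text \<open>No rule compares abstractions through their open bodies. The omega rule takes this role:
  applied to a closed argument, both sides contract to instances known to be equal.\<close>

lemma closed_instances_eq_abs: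
  assumes "closed_at (Suc k) U" "closed_at (Suc k) V" "closed_instances_eq (Suc k) U V"
  shows "closed_instances_eq k (Abs U) (Abs V)"
  using assms
proof (induction k arbitrary: U V)
  case 0
  have "Abs U =\<^sub>\<omega> Abs V"
  proof (rule oe_omega_rule)
    fix M assume M: "closed_term M"
    have "Abs U \<degree> M =\<^sub>\<omega> subst M 0 U"
      using 0 M by (intro oe_beta) simp
    also have "subst M 0 U =\<^sub>\<omega> subst M 0 V"
      using 0 M by simp
    also have "subst M 0 V =\<^sub>\<omega> Abs V \<degree> M"
      using 0 M by (intro oe_beta_sym) simp
    finally show "Abs U \<degree> M =\<^sub>\<omega> Abs V \<degree> M" .
  qed (use 0 in auto)
  then show ?case
    by simp
next
  case (Suc k)
  have "closed_instances_eq k (Abs (subst P (Suc k) U)) (Abs (subst P (Suc k) V))"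
    if "closed_term P" for P
    using Suc.prems that by (intro Suc.IH) (auto intro: closed_at_subst)
  then show ?case
    by simp
qed

lemma closed_instances_eq_redex:
  "closed_at k (Abs U \<degree> N) \<Longrightarrow> closed_instances_eq k (Abs U \<degree> N) (subst N 0 U)"
proof (induction k arbitrary: U N)
  case 0
  then show ?case
    by (auto intro: oe_beta)
next
  case (Suc k)
  have "closed_instances_eq k (Abs (subst P (Suc k) U) \<degree> subst P k N)
      (subst (subst P k N) 0 (subst P (Suc k) U))" if "closed_term P" for P
    using Suc.prems that by (intro Suc.IH) (auto intro: closed_at_subst)
  then show ?case
    by (simp add: subst_subst)
qed

lemma beta_imp_closed_instances_eq:
  "beta M N \<Longrightarrow> closed_at k M \<Longrightarrow> closed_instances_eq k M N"
proof (induction arbitrary: k rule: beta.induct)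
  case (beta_abs M M')
  then show ?case
    using closed_at_beta by (intro closed_instances_eq_abs) (simp_all del: closed_instances_eq.simps)
qed (auto intro: closed_instances_eq_redex closed_instances_eq_app closed_instances_eq_refl)

lemma beta_star_imp_omega_eq: "beta\<^sup>*\<^sup>* M N \<Longrightarrow> closed_term M \<Longrightarrow> M =\<^sub>\<omega> N"
proof (induction rule: rtranclp_induct)
  case (step N P)
  then have "N =\<^sub>\<omega> P"
    using beta_imp_closed_instances_eq[of N P 0] closed_at_beta_star by simp
  with step show ?case
    by (blast intro: omega_eq_trans)
qed (rule oe_refl)

text \<open>A conversion between closed terms may pass through open ones. Confluence replaces it by
  two reductions to a common term, along which closedness is preserved.\<close>

lemma beta_conv_imp_omega_eq:
  assumes "M =\<^sub>\<beta> N" "closed_term M" "closed_term N"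
  shows "M =\<^sub>\<omega> N"
  using beta_conv_joinable[OF assms(1)] assms(2,3)
  by (blast intro: beta_star_imp_omega_eq omega_eq_sym omega_eq_trans)

section \<open>Equations for pairs, the fixed point combinator and Church numerals\<close>

lemma omega_eq_beta2:
  assumes "closed_at 2 U" "closed_term A" "closed_term B"
  shows "Abs (Abs U) \<degree> A \<degree> B =\<^sub>\<omega> subst B 0 (subst A 1 U)"
proof -
  have U: "closed_at 1 (subst A 1 U)"
    using assms by (intro closed_at_subst) (simp_all add: numeral_2_eq_2)
  have "Abs (Abs U) \<degree> A =\<^sub>\<omega> Abs (subst A 1 U)"
    using oe_beta[of "Abs U" A] assms by (simp add: numeral_2_eq_2)
  then have "Abs (Abs U) \<degree> A \<degree> B =\<^sub>\<omega> Abs (subst A 1 U) \<degree> B"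
    using assms by (intro omega_eq_app oe_refl)
  also have "Abs (subst A 1 U) \<degree> B =\<^sub>\<omega> subst B 0 (subst A 1 U)"
    using U assms by (intro oe_beta) simp
  finally show ?thesis .
qed

lemma omega_eq_beta3:
  assumes "closed_at 3 U" "closed_term A" "closed_term B" "closed_term C"
  shows "Abs (Abs (Abs U)) \<degree> A \<degree> B \<degree> C =\<^sub>\<omega> subst C 0 (subst B 1 (subst A 2 U))"
proof -
  have U: "closed_at 2 (subst A 2 U)"
    using assms by (intro closed_at_subst) simp_all
  have "Abs (Abs (Abs U)) \<degree> A =\<^sub>\<omega> Abs (Abs (subst A 2 U))"
    using oe_beta[of "Abs (Abs U)" A] assms by (simp add: numeral_3_eq_3 numeral_2_eq_2)
  then have "Abs (Abs (Abs U)) \<degree> A \<degree> B \<degree> C =\<^sub>\<omega> Abs (Abs (subst A 2 U)) \<degree> B \<degree> C"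
    using assms by (intro omega_eq_app oe_refl)
  also have "Abs (Abs (subst A 2 U)) \<degree> B \<degree> C =\<^sub>\<omega> subst C 0 (subst B 1 (subst A 2 U))"
    using U assms by (intro omega_eq_beta2)
  finally show ?thesis .
qed

lemma omega_eq_Omega_app: "closed_term N \<Longrightarrow> Omega \<degree> N =\<^sub>\<omega> Omega"
  by (intro oe_Omega unsolvable_app unsolvable_Omega)

lemma pair_trm_app:
  assumes "closed_term A" "closed_term B" "closed_term P"
  shows "pair_trm A B \<degree> P =\<^sub>\<omega> P \<degree> A \<degree> B"
  using oe_beta[of "Var 0 \<degree> A \<degree> B" P] assms by (simp add: pair_trm_def)

text \<open>The omega rule frees both components from the binder: applied to a closed
  \<open>P\<close>, a pair becomes \<open>P \<degree> A \<degree> B\<close>, where congruence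
  applies.\<close>

lemma omega_eq_pair_trm:
  assumes "A =\<^sub>\<omega> A'" "B =\<^sub>\<omega> B'"
  shows "pair_trm A B =\<^sub>\<omega> pair_trm A' B'"
proof (rule oe_omega_rule)
  note closed = assms[THEN omega_eq_closed]
  fix P assume P: "closed_term P"
  have "pair_trm A B \<degree> P =\<^sub>\<omega> P \<degree> A \<degree> B"
    using closed P by (intro pair_trm_app) auto
  also have "P \<degree> A \<degree> B =\<^sub>\<omega> P \<degree> A' \<degree> B'"
    using assms P by (intro omega_eq_app oe_refl)
  also have "P \<degree> A' \<degree> B' =\<^sub>\<omega> pair_trm A' B' \<degree> P"
    using closed P by (intro omega_eq_sym[OF pair_trm_app]) auto
  finally show "pair_trm A B \<degree> P =\<^sub>\<omega> pair_trm A' B' \<degree> P" .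
qed (use assms[THEN omega_eq_closed] in auto)

text \<open>\<open>Theta\<close> is Turing's fixed point combinator: contracting its first half with
  the second half and \<open>F\<close> as arguments already gives the unfolding.\<close>

lemma Theta_unfold:
  assumes "closed_term F"
  shows "Theta \<degree> F =\<^sub>\<omega> F \<degree> (Theta \<degree> F)"
  using omega_eq_beta2[of "Var 0 \<degree> (Var 1 \<degree> Var 1 \<degree> Var 0)" Theta_half F, folded Theta_half_def] assms
  by (simp add: Theta_def)

lemma church_app:
  assumes "closed_term H" "closed_term M"
  shows "church k \<degree> H \<degree> M =\<^sub>\<omega> ((\<lambda>N. H \<degree> N) ^^ k) M"
proof -
  have "closed_at 2 (((\<lambda>N. Var 1 \<degree> N) ^^ k) (Var 0))"
    by (induction k) auto
  moreover have "subst M 0 (subst H 1 (((\<lambda>N. Var 1 \<degree> N) ^^ k) (Var 0))) = ((\<lambda>N. H \<degree> N) ^^ k) M"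
    using assms by (induction k) auto
  ultimately show ?thesis
    using omega_eq_beta2 assms unfolding church_def by metis
qed

text \<open>Each of the \<open>k\<close> iterations appends one \<open>Omega\<close>; this turns the
  counter of the stream into the length of its guard.\<close>

lemma church_app_Omega:
  assumes "closed_term M"
  shows "church k \<degree> Abs (Var 0 \<degree> Omega) \<degree> M =\<^sub>\<omega> apps M (replicate k Omega)"
proof -
  let ?H = "Abs (Var 0 \<degree> Omega)"
  have "((\<lambda>N. ?H \<degree> N) ^^ k) M =\<^sub>\<omega> apps M (replicate k Omega)"
  proof (induction k)
    case 0
    then show ?case
      using assms by (simp add: oe_refl)
  next
    case (Suc k)
    let ?N = "((\<lambda>N. ?H \<degree> N) ^^ k) M"
    have "?H \<degree> ?N =\<^sub>\<omega> ?N \<degree> Omega"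
      using oe_beta[of "Var 0 \<degree> Omega" ?N] omega_eq_closed[OF Suc] by simp
    also have "?N \<degree> Omega =\<^sub>\<omega> apps M (replicate k Omega) \<degree> Omega"
      using Suc by (intro omega_eq_app oe_refl) auto
    finally show ?case
      by (simp flip: replicate_append_same)
  qed
  then show ?thesis
    using church_app[of ?H M k] assms by (auto intro: omega_eq_trans)
qed


section \<open>The terms $B_i$\<close>

lemma closed_G_inst [simp]:
  "closed_term Sc \<Longrightarrow> closed_term M \<Longrightarrow> closed_term (subst M 0 (G_trm Sc))"
  by (simp add: G_trm_def pair_trm_def)

lemma G_inst_app:
  assumes "closed_term Sc" "closed_term M" "closed_term A" "closed_term K" "closed_term F"
  shows "subst M 0 (G_trm Sc) \<degree> A \<degree> K \<degree> F =\<^sub>\<omega>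
    pair_trm (F \<degree> K) (K \<degree> Abs (Var 0 \<degree> Omega) \<degree> M \<degree> (A \<degree> (Sc \<degree> K) \<degree> F))"
  using omega_eq_beta3[of "pair_trm (Var 0 \<degree> Var 1)
     (Var 1 \<degree> Abs (Var 0 \<degree> Omega) \<degree> M \<degree> (Var 2 \<degree> (Sc \<degree> Var 1) \<degree> Var 0))" A K F] assms
  by (simp add: G_trm_def pair_trm_def)

text \<open>Unfolding the fixed point once exposes \<open>G_trm\<close>, whose counter serves three
  times: as index of the entry, as length of the guard and, increased, as counter of the next
  round.\<close>

lemma Theta_G_unfold:
  assumes Sc: "closed_term Sc" "\<And>k. Sc \<degree> church k =\<^sub>\<omega> church (Suc k)"
    and M: "closed_term M" and F: "closed_term F"
  defines "A \<equiv> Theta \<degree> subst M 0 (G_trm Sc)"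
  shows "A \<degree> church k \<degree> F =\<^sub>\<omega>
    pair_trm (F \<degree> church k) (apps M (replicate k Omega) \<degree> (A \<degree> church (Suc k) \<degree> F))"
proof -
  have A: "closed_term A"
    using Sc M by (simp add: A_def)
  have "A \<degree> church k \<degree> F =\<^sub>\<omega> subst M 0 (G_trm Sc) \<degree> A \<degree> church k \<degree> F"
    unfolding A_def using Sc M F by (intro omega_eq_app oe_refl Theta_unfold) simp_all
  also have "\<dots> =\<^sub>\<omega> pair_trm (F \<degree> church k)
      (church k \<degree> Abs (Var 0 \<degree> Omega) \<degree> M \<degree> (A \<degree> (Sc \<degree> church k) \<degree> F))"
    using Sc M F A by (intro G_inst_app) simp_all
  also have "\<dots> =\<^sub>\<omega> pair_trm (F \<degree> church k)
      (apps M (replicate k Omega) \<degree> (A \<degree> church (Suc k) \<degree> F))"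
    using Sc M F A
    by (intro omega_eq_pair_trm omega_eq_app church_app_Omega) (simp_all add: oe_refl)
  finally show ?thesis .
qed

text \<open>The tail of the stream at position \<open>k\<close> is guarded by \<open>M Omega ... Omega\<close>, hence equal to
  \<open>Omega\<close> for some \<open>k\<close>; the streams are therefore determined by finitely many entries.\<close>

lemma Theta_G_cong:
  assumes Sc: "closed_term Sc" "\<And>k. Sc \<degree> church k =\<^sub>\<omega> church (Suc k)"
    and M: "closed_term M" and F: "closed_term F" "closed_term F'"
    and eq: "\<And>k. F \<degree> church k =\<^sub>\<omega> F' \<degree> church k"
  shows "Theta \<degree> subst M 0 (G_trm Sc) \<degree> church k \<degree> F =\<^sub>\<omega>
    Theta \<degree> subst M 0 (G_trm Sc) \<degree> church k \<degree> F'"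
proof -
  let ?A = "Theta \<degree> subst M 0 (G_trm Sc)"
  have A: "closed_term ?A"
    using Sc M by simp
  note unfold = Theta_G_unfold[OF Sc M]
  \<comment> \<open>Going backwards: the entries agree, so agreement of the guarded tails at
    \<open>k\<close> gives agreement of the streams from \<open>k\<close> on.\<close>
  have cons: "?A \<degree> church k \<degree> F =\<^sub>\<omega> ?A \<degree> church k \<degree> F'"
    if "apps M (replicate k Omega) \<degree> (?A \<degree> church (Suc k) \<degree> F) =\<^sub>\<omega>
      apps M (replicate k Omega) \<degree> (?A \<degree> church (Suc k) \<degree> F')" for k
    by (rule omega_eq_trans[OF unfold[OF F(1)] omega_eq_trans[OF
        omega_eq_pair_trm[OF eq that] omega_eq_sym[OF unfold[OF F(2)]]]])
  obtain m where m: "unsolvable (apps M (replicate m Omega))"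
    using unsolvable_apps_Omega[OF M] ..
  have "unsolvable (apps M (replicate (m + k) Omega))"
    using m by (induction k) (auto simp: unsolvable_app simp flip: replicate_append_same)
  then have "apps M (replicate (m + k) Omega) \<degree> N =\<^sub>\<omega> Omega" if "closed_term N" for N
    using that by (intro oe_Omega unsolvable_app)
  then have "?A \<degree> church (m + k) \<degree> F =\<^sub>\<omega> ?A \<degree> church (m + k) \<degree> F'"
    using A F by (intro cons) (rule omega_eq_trans[of _ Omega, OF _ omega_eq_sym]; simp)
  \<comment> \<open>The index \<open>m + k\<close> is at least \<open>m\<close> and at least
    \<open>k\<close>; from there the induction descends to \<open>k\<close>.\<close>
  then obtain n where "k \<le> n" "?A \<degree> church n \<degree> F =\<^sub>\<omega> ?A \<degree> church n \<degree> F'"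
    using le_add2 by blast
  then show ?thesis
  proof (induction rule: inc_induct)
    case (step j)
    then show ?case
      using M by (auto simp: closed_term_apps intro!: cons[of j] omega_eq_app[OF oe_refl])
  qed
qed

section \<open>The terms \<open>B_trm\<close> at nodes inside and outside the tree\<close>

lemma closed_B_trm [simp]:
  assumes "closed_term D" "closed_term cc" "closed_term Sc"
  shows "closed_term (B_trm D cc Sc i)"
  using assms by (simp add: B_trm_def F_trm_def G_trm_def pair_trm_def)

lemma B_trm_app:
  assumes "closed_term D" "closed_term cc" "closed_term Sc" "closed_term S" "closed_term M"
  shows "B_trm D cc Sc i \<degree> S \<degree> M =\<^sub>\<omega>
    D \<degree> S \<degree> church i \<degree> Theta_half \<degree> Theta_half \<degree> subst M 0 (G_trm Sc) \<degree> church 0 \<degree>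
      Abs (B_trm D cc Sc i \<degree> (cc \<degree> S \<degree> Var 0))"
proof -
  let ?B = "B_trm D cc Sc i" and ?F = "F_trm D cc Sc i"
  have F: "closed_term ?F"
    using assms closed_B_trm[of D cc Sc i] by (simp add: B_trm_def)
  have G: "closed_at 1 (G_trm Sc)"
    using assms by (simp add: G_trm_def pair_trm_def)
  \<comment> \<open>\<open>G_trm\<close> mentions only \<open>y\<close>, which has index 0, so the
    values given to \<open>x\<close> and \<open>w\<close> do not enter it.\<close>
  then have "subst A j (G_trm Sc) = G_trm Sc" if "j \<ge> 1" for A j
    using that by (rule subst_closed_at)
  then have "?F \<degree> ?B \<degree> S \<degree> M =\<^sub>\<omega> D \<degree> S \<degree> church i \<degree> Theta_half \<degree> Theta_half \<degree>
      subst M 0 (G_trm Sc) \<degree> church 0 \<degree> Abs (?B \<degree> (cc \<degree> S \<degree> Var 0))"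
    using omega_eq_beta3[of "D \<degree> Var 1 \<degree> church i \<degree> Theta_half \<degree> Theta_half \<degree> G_trm Sc \<degree>
      church 0 \<degree> Abs (Var 3 \<degree> (cc \<degree> Var 2 \<degree> Var 0))" ?B S M] assms closed_at_mono[OF G, of 3]
    by (simp add: F_trm_def)
  moreover have "?B \<degree> S \<degree> M =\<^sub>\<omega> ?F \<degree> ?B \<degree> S \<degree> M"
    unfolding B_trm_def using assms F by (intro omega_eq_app oe_refl Theta_unfold)
  ultimately show ?thesis
    by (blast intro: omega_eq_trans)
qed

text \<open>\<open>Omega\<close> absorbs the remaining arguments, and with them all dependence on
  \<open>i\<close>.\<close>

lemma B_trm_app_notin:
  assumes closed: "closed_term D" "closed_term cc" "closed_term Sc" "closed_term S" "closed_term M"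
    and D: "D \<degree> S =\<^sub>\<omega> Omega"
  shows "B_trm D cc Sc i \<degree> S \<degree> M =\<^sub>\<omega> Omega"
proof -
  have app: "X \<degree> N =\<^sub>\<omega> Omega" if "X =\<^sub>\<omega> Omega" "closed_term N" for X N
    using omega_eq_app[OF that(1) oe_refl[OF that(2)]] omega_eq_Omega_app[OF that(2)]
    by (rule omega_eq_trans)
  show ?thesis
    by (rule omega_eq_trans[OF B_trm_app[OF closed]]) (intro app D; simp add: closed)
qed

text \<open>\<open>K_star\<close> discards \<open>church i\<close> and returns the first
  \<open>Theta_half\<close>, which forms \<open>Theta\<close> with the second one. The index
  \<open>i\<close> survives only in the recursive calls.\<close>

lemma B_trm_app_in:
  assumes closed: "closed_term D" "closed_term cc" "closed_term Sc" "closed_term S" "closed_term M"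
    and D: "D \<degree> S =\<^sub>\<omega> K_star"
  shows "B_trm D cc Sc i \<degree> S \<degree> M =\<^sub>\<omega>
    Theta \<degree> subst M 0 (G_trm Sc) \<degree> church 0 \<degree> Abs (B_trm D cc Sc i \<degree> (cc \<degree> S \<degree> Var 0))"
proof -
  have "D \<degree> S \<degree> church i \<degree> Theta_half =\<^sub>\<omega> K_star \<degree> church i \<degree> Theta_half"
    using D by (intro omega_eq_app oe_refl) simp_all
  also have "\<dots> =\<^sub>\<omega> Theta_half"
    using omega_eq_beta2[of "Var 0" "church i" Theta_half] by (simp add: K_star_def)
  finally show ?thesis
    unfolding Theta_def
    by (intro omega_eq_trans[OF B_trm_app[OF closed]] omega_eq_app oe_refl) (simp_all add: closed)
qed

section \<open>From a node of disagreement to an infinite branch\<close>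

theorem theorem8p5:
  fixes code :: "nat list \<Rightarrow> nat"
    and P :: "nat \<Rightarrow> bool" and R :: "nat \<Rightarrow> nat \<Rightarrow> bool" and n :: nat
    and T :: "nat set" and D cc Sc :: trm
  assumes coding: "effective_coding code"
    and R_recursive: "recursive_rel R"
    and P_iff: "\<forall>k. P k \<longleftrightarrow> (\<forall>f :: nat \<Rightarrow> nat. \<exists>m. R (initial_code code f m) k)"
    and T_eq: "T = unsecured_tree code R n"
    and cc_closed: "closed_term cc"
    and cc_represents: "\<forall>xs a. cc \<degree> church (code xs) \<degree> church a =\<^sub>\<beta> church (code (xs @ [a]))"
    and cc_nf: "\<forall>s \<in> range code. \<exists>N. has_betaOmega_nf (cc \<degree> church s \<degree> Var 0) N \<and> begins_with 0 N"
    and Sc_closed: "closed_term Sc"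
    and Sc_represents: "\<forall>k. Sc \<degree> church k =\<^sub>\<beta> church (Suc k)"
    and D_closed: "closed_term D"
    and D_nf: "\<forall>m. \<exists>N. has_betaOmega_nf (D \<degree> Var 0 \<degree> church m) N \<and>
                 begins_with 0 N \<and> occurs_in (church m) N"
    and D_in: "\<forall>s \<in> range code. s \<in> T \<longrightarrow> D \<degree> church s =\<^sub>\<omega> K_star"
    and D_notin: "\<forall>s \<in> range code. s \<notin> T \<longrightarrow> D \<degree> church s =\<^sub>\<omega> Omega"
    and D_head: "\<forall>s \<in> range code. s \<in> T \<longrightarrow> closed_head_beta\<^sup>*\<^sup>* (D \<degree> church s) K_star"
  shows "\<forall>s \<in> range code. well_founded_tree code (subtree code T s) \<longrightarrow>
           B_trm D cc Sc 0 \<degree> church s =\<^sub>\<omega> B_trm D cc Sc 1 \<degree> church s"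
proof (intro ballI impI)
  let ?eq = "\<lambda>xs. B_trm D cc Sc 0 \<degree> church (code xs) =\<^sub>\<omega> B_trm D cc Sc 1 \<degree> church (code xs)"
  note closed = D_closed cc_closed Sc_closed
  have Sc_omega: "Sc \<degree> church k =\<^sub>\<omega> church (Suc k)" for k
    using Sc_represents Sc_closed by (intro beta_conv_imp_omega_eq) simp_all
  have cc_omega: "cc \<degree> church (code xs) \<degree> church a =\<^sub>\<omega> church (code (xs @ [a]))" for xs a
    using cc_represents cc_closed by (intro beta_conv_imp_omega_eq) simp_all
  have notin: "?eq xs" if "code xs \<notin> T" for xs
  proof (rule oe_omega_rule)
    fix M assume M: "closed_term M"
    have "D \<degree> church (code xs) =\<^sub>\<omega> Omega"
      using D_notin that by simp
    note B = B_trm_app_notin[OF closed closed_church M this]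
    show "B_trm D cc Sc 0 \<degree> church (code xs) \<degree> M =\<^sub>\<omega> B_trm D cc Sc 1 \<degree> church (code xs) \<degree> M"
      by (rule omega_eq_trans[OF B omega_eq_sym[OF B]])
  qed (simp_all add: closed)
  \<comment> \<open>The step back from the children to their parent; its contrapositive later
    extends the branch.\<close>
  have children: "?eq xs" if T: "code xs \<in> T" and IH: "\<And>a. ?eq (xs @ [a])" for xs
  proof (rule oe_omega_rule)
    fix M assume M: "closed_term M"
    have "D \<degree> church (code xs) =\<^sub>\<omega> K_star"
      using D_in T by simp
    note B = B_trm_app_in[OF closed closed_church M this]
    let ?f = "\<lambda>i. Abs (B_trm D cc Sc i \<degree> (cc \<degree> church (code xs) \<degree> Var 0))"
    have f: "closed_term (?f i)" for i
      using closed by simp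
    have f_app: "?f i \<degree> church a =\<^sub>\<omega> B_trm D cc Sc i \<degree> church (code (xs @ [a]))" for i a
    proof -
      have "?f i \<degree> church a =\<^sub>\<omega> B_trm D cc Sc i \<degree> (cc \<degree> church (code xs) \<degree> church a)"
        using oe_beta[of "B_trm D cc Sc i \<degree> (cc \<degree> church (code xs) \<degree> Var 0)" "church a"] closed
        by simp
      also have "\<dots> =\<^sub>\<omega> B_trm D cc Sc i \<degree> church (code (xs @ [a]))"
        using closed by (intro omega_eq_app oe_refl cc_omega) simp
      finally show ?thesis .
    qed
    \<comment> \<open>The entry functions are compared at numerals only, which is all that
      \<open>Theta_G_cong\<close> asks for; nothing is claimed at other closed arguments.\<close>
    have "?f 0 \<degree> church a =\<^sub>\<omega> ?f 1 \<degree> church a" for a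
      by (rule omega_eq_trans[OF f_app omega_eq_trans[OF IH omega_eq_sym[OF f_app]]])
    note Theta_G_cong[OF Sc_closed Sc_omega M f f this, of 0]
    then show "B_trm D cc Sc 0 \<degree> church (code xs) \<degree> M =\<^sub>\<omega> B_trm D cc Sc 1 \<degree> church (code xs) \<degree> M"
      by (rule omega_eq_trans[OF B omega_eq_trans[OF _ omega_eq_sym[OF B]]])
  qed (simp_all add: closed)
  fix s assume "s \<in> range code" and wf: "well_founded_tree code (subtree code T s)"
  then obtain xs where s: "s = code xs"
    by blast
  show "B_trm D cc Sc 0 \<degree> church s =\<^sub>\<omega> B_trm D cc Sc 1 \<degree> church s"
  proof (rule ccontr)
    assume "\<not> B_trm D cc Sc 0 \<degree> church s =\<^sub>\<omega> B_trm D cc Sc 1 \<degree> church s"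
    then have neq: "\<not> ?eq xs"
      by (simp add: s)
    \<comment> \<open>The branch runs through nodes of disagreement; the prefix condition is carried
      along to keep it in the subtree at \<open>s\<close>.\<close>
    have "\<exists>p. \<forall>i. (\<not> ?eq (p i) \<and> prefix xs (p i)) \<and> strict_prefix (p i) (p (Suc i))"
    proof (rule dependent_nat_choice)
      show "\<exists>ys. \<not> ?eq ys \<and> prefix xs ys"
        using neq by blast
    next
      fix ys and i :: nat assume ys: "\<not> ?eq ys \<and> prefix xs ys"
      \<comment> \<open>A node of disagreement lies in \<open>T\<close> by \<open>notin\<close>, so
        \<open>children\<close> yields a child where the terms still differ.\<close>
      then obtain a where "\<not> ?eq (ys @ [a])"
        using notin children by blast
      then show "\<exists>zs. (\<not> ?eq zs \<and> prefix xs zs) \<and> strict_prefix ys zs"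
        using ys by (intro exI[of _ "ys @ [a]"]) (auto simp: strict_prefix_def)
    qed
    then obtain p where p: "\<not> ?eq (p i)" "prefix xs (p i)" "strict_prefix (p i) (p (Suc i))" for i
      by blast
    \<comment> \<open>By \<open>notin\<close> every \<open>p i\<close> lies in \<open>T\<close>, and
      so does the root \<open>s\<close>, without which the subtree would be empty by
      definition.\<close>
    have "code (p i) \<in> subtree code T s" for i
      using notin neq p(1,2)[of i] unfolding subtree_def seq_less_def s
      by (auto simp: strict_prefix_def)
    moreover have "seq_less code (code (p i)) (code (p (Suc i)))" for i
      using p(3) unfolding seq_less_def by blast
    ultimately show False
      using wf unfolding well_founded_tree_def by (auto dest!: spec[of _ "\<lambda>i. code (p i)"])
  qed
qed

end
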